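(* Let $X$ be a separable metric space and $X=\bigcup_{n\in\mathbb{N}}X_n$, where each $X_n$ $(n\in\mathbb{N})$ is a closed subset of $X$. Then $$\dim_{tH}X=\sup_{n\in\mathbb{N}}\dim_{tH}X_n.$$
   Context: $\dim_H$ denotes Hausdorff dimension, with the convention $\dim_H\emptyset=-1$. The topological Hausdorff dimension is defined by $\dim_{tH}\emptyset=-1$ and, for a non-empty metric space $X$, $\dim_{tH}X=\inf\{d: X \text{ has a basis } \mathcal U \text{ of open sets such that } \dim_H\partial U\le d-1 \text{ for every } U\in\mathcal U\}$ (where $d=\infty$ is allowed, with $\infty-1=\infty$). Subsets carry the subspace metric. *)

theory Defs
  imports "HOL-Analysis.Analysis"
begin

text \<open>
  A metric space is a set \<open>X\<close> of points of a type of class \<open>metric_space\<close>, with the metric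
  inherited from the type and the topology \<open>top_of_set X\<close>; a subspace is then just a subset.
\<close>

text \<open>
  The summand \<open>(diam U)\<^sup>s\<close> of the Hausdorff sums. For \<open>s = 0\<close> the convention is
  \<open>(diam U)\<^sup>0 = 1\<close> for every nonempty \<open>U\<close>, singletons included (so that \<open>H\<^sup>0\<close> is counting
  measure), whereas \<open>0 powr 0 = 0\<close> in HOL. The empty set contributes \<open>0\<close>, so that
  sequences of covering sets also represent finite covers.
\<close>

definition diam_pow :: "real \<Rightarrow> 'a::metric_space set \<Rightarrow> ennreal" where
  "diam_pow s U =
     (if U = {} then 0 else if s = 0 then 1 else ennreal (diameter U powr s))"

text \<open>
  The library's \<open>diameter\<close> is meaningful only on bounded sets, hence the explicit
  boundedness requirement.
\<close>

definition hausdorff_premeasure ::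
    "real \<Rightarrow> real \<Rightarrow> 'a::metric_space set \<Rightarrow> ennreal" where
  "hausdorff_premeasure s \<delta> X =
     Inf {(\<Sum>i. diam_pow s (C i)) | C :: nat \<Rightarrow> 'a set.
            X \<subseteq> (\<Union>i. C i) \<and> (\<forall>i. bounded (C i) \<and> diameter (C i) \<le> \<delta>)}"

text \<open>The premeasure increases as \<open>\<delta>\<close> decreases, so its limit at \<open>0+\<close> is the supremum.\<close>

definition hausdorff_measure :: "real \<Rightarrow> 'a::metric_space set \<Rightarrow> ennreal" where
  "hausdorff_measure s X = (SUP \<delta>\<in>{0<..}. hausdorff_premeasure s \<delta> X)"

definition hausdorff_dim :: "'a::metric_space set \<Rightarrow> ereal" where
  "hausdorff_dim X =
     (if X = {} then -1
      else Inf {ereal s | s. 0 \<le> s \<and> hausdorff_measure s X < \<infinity>})"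

text \<open>A basis of open sets, as in the library's \<open>second_countable\<close>.\<close>

definition is_open_basis :: "'a topology \<Rightarrow> 'a set set \<Rightarrow> bool" where
  "is_open_basis T \<B> \<longleftrightarrow>
     (\<forall>U\<in>\<B>. openin T U) \<and>
     (\<forall>V x. openin T V \<and> x \<in> V \<longrightarrow> (\<exists>U\<in>\<B>. x \<in> U \<and> U \<subseteq> V))"

text \<open>
  Boundaries are taken relative to \<open>X\<close>. The value \<open>d = \<infinity>\<close> is admitted, with
  \<open>\<infinity> - 1 = \<infinity>\<close> in \<open>ereal\<close>; no negative \<open>d\<close> qualifies, since \<open>hausdorff_dim\<close> is at
  least \<open>-1\<close> and a basis of a nonempty space is nonempty.
\<close>

definition top_hausdorff_dim :: "'a::metric_space set \<Rightarrow> ereal" where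
  "top_hausdorff_dim X =
     (if X = {} then -1
      else Inf {d :: ereal. \<exists>\<B>. is_open_basis (top_of_set X) \<B> \<and>
                  (\<forall>U\<in>\<B>. hausdorff_dim (top_of_set X frontier_of U) \<le> d - 1)})"

end

theory Submission
  imports Defs
begin

text \<open>
  If \<open>d\<close> exceeds every \<open>dim\<^sub>t\<^sub>H X\<^sub>n\<close>, then the boundaries of a countable basis of \<open>X\<^sub>n\<close> form a set
  \<open>A\<^sub>n\<close> with \<open>dim\<^sub>H A\<^sub>n \<le> d - 1\<close> whose complement in \<open>X\<^sub>n\<close> is zero-dimensional. Put \<open>A = \<Union>\<^sub>n A\<^sub>n\<close>. Then
  \<open>dim\<^sub>H A \<le> d - 1\<close> and \<open>X - A\<close> is a countable union of relatively closed zero-dimensional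
  sets. The argument of the sum theorem of dimension theory yields, for any disjoint closed
  \<open>E, F \<subseteq> X\<close>, disjoint open \<open>U \<supseteq> E\<close> and \<open>V \<supseteq> F\<close> with \<open>X - A \<subseteq> U \<union> V\<close>. The boundary of \<open>U\<close> then
  lies in \<open>A\<close>, so sets with such boundaries form a basis of \<open>X\<close>.
\<close>

section \<open>Hausdorff dimension\<close>

lemma hausdorff_premeasure_mono:
  assumes "X \<subseteq> Y"
  shows "hausdorff_premeasure s \<delta> X \<le> hausdorff_premeasure s \<delta> Y"
  unfolding hausdorff_premeasure_def setcompr_eq_image using assms
  by (intro Inf_superset_mono image_mono) auto

lemma hausdorff_premeasure_antimono:
  assumes "\<epsilon> \<le> \<delta>"
  shows "hausdorff_premeasure s \<delta> X \<le> hausdorff_premeasure s \<epsilon> X"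
  unfolding hausdorff_premeasure_def setcompr_eq_image using assms
  by (intro Inf_superset_mono image_mono) (auto intro: order_trans)

lemma hausdorff_premeasure_le:
  assumes "X \<subseteq> (\<Union>i. C i)" "\<And>i. bounded (C i)" "\<And>i. diameter (C i) \<le> \<delta>"
  shows "hausdorff_premeasure s \<delta> X \<le> (\<Sum>i. diam_pow s (C i))"
  unfolding hausdorff_premeasure_def using assms by (intro Inf_lower) blast

lemma hausdorff_premeasure_lessD:
  assumes "hausdorff_premeasure s \<delta> X < m"
  obtains C :: "nat \<Rightarrow> 'a::metric_space set"
  where "X \<subseteq> (\<Union>i. C i)" "\<And>i. bounded (C i)" "\<And>i. diameter (C i) \<le> \<delta>"
    "(\<Sum>i. diam_pow s (C i)) < m"
  using assms unfolding hausdorff_premeasure_def Inf_less_iff by auto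

lemma hausdorff_premeasure_le_measure:
  "\<delta> > 0 \<Longrightarrow> hausdorff_premeasure s \<delta> X \<le> hausdorff_measure s X"
  unfolding hausdorff_measure_def by (intro SUP_upper) simp

lemma hausdorff_measure_eq_0I:
  assumes "\<And>\<delta> e. \<delta> > 0 \<Longrightarrow> e > 0 \<Longrightarrow> hausdorff_premeasure s \<delta> X \<le> ennreal e"
  shows "hausdorff_measure s X = 0"
proof -
  have "hausdorff_premeasure s \<delta> X \<le> 0" if "\<delta> > 0" for \<delta>
  proof (rule ennreal_le_epsilon)
    fix e :: real assume "e > 0"
    then show "hausdorff_premeasure s \<delta> X \<le> 0 + ennreal e"
      using assms[OF that] by simp
  qed
  then have "hausdorff_measure s X \<le> 0"
    unfolding hausdorff_measure_def by (intro SUP_least) simp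
  then show ?thesis
    by simp
qed

lemma hausdorff_measure_mono:
  "X \<subseteq> Y \<Longrightarrow> hausdorff_measure s X \<le> hausdorff_measure s Y"
  unfolding hausdorff_measure_def by (intro SUP_mono') (rule hausdorff_premeasure_mono)

lemma hausdorff_measure_empty [simp]: "hausdorff_measure s ({} :: 'a::metric_space set) = 0"
proof (rule hausdorff_measure_eq_0I)
  fix \<delta> e :: real assume "\<delta> > 0"
  then show "hausdorff_premeasure s \<delta> ({} :: 'a set) \<le> ennreal e"
    using hausdorff_premeasure_le[of "{}" "\<lambda>_. {} :: 'a set" \<delta> s] by (simp add: diam_pow_def)
qed

text \<open>The surplus exponent \<open>t - s\<close> contributes a factor
  \<open>diameter U powr (t - s)\<close>, which is at most
  \<open>\<delta> powr (t - s)\<close>.\<close>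

lemma diam_pow_le_mult:
  assumes "0 \<le> s" "s < t" "bounded U" "diameter U \<le> \<delta>" "\<delta> > 0"
  shows "diam_pow t U \<le> ennreal (\<delta> powr (t - s)) * diam_pow s U"
proof -
  have d: "diameter U \<ge> 0"
    using assms(3) by (rule diameter_ge_0)
  have "diameter U powr t \<le> \<delta> powr (t - s) * diameter U powr s"
  proof -
    have "diameter U powr t = diameter U powr (t - s) * diameter U powr s"
      by (simp flip: powr_add)
    also have "\<dots> \<le> \<delta> powr (t - s) * diameter U powr s"
      using assms d by (intro mult_right_mono powr_mono2) auto
    finally show ?thesis .
  qed
  \<comment> \<open>This bound serves the case \<open>s = 0\<close>: there
    \<open>diam_pow 0 U = 1\<close> even for a singleton, while \<open>0 powr 0 = 0\<close> makes
    the product bound above too weak.\<close>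
  moreover have "diameter U powr t \<le> \<delta> powr t"
    using assms d by (intro powr_mono2) auto
  ultimately show ?thesis
    using assms by (auto simp: diam_pow_def ennreal_mult'[symmetric] intro!: ennreal_leI)
qed

text \<open>Covers of mesh \<open>\<epsilon>\<close> with \<open>s\<close>-sum below a fixed
  \<open>K\<close> have \<open>t\<close>-sum at most \<open>\<epsilon> powr (t - s) * K\<close>, and
  this tends to 0 with \<open>\<epsilon>\<close>.\<close>

lemma hausdorff_measure_eq_0_above:
  fixes X :: "'a::metric_space set"
  assumes "0 \<le> s" "s < t" "hausdorff_measure s X < \<infinity>"
  shows "hausdorff_measure t X = 0"
proof -
  \<comment> \<open>A bound strictly above the measure guarantees a cover with \<open>s\<close>-sum
    below \<open>K\<close> at every scale; positivity allows division by \<open>K\<close>.\<close>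
  obtain K where K: "K > 0" "hausdorff_measure s X < ennreal K"
  proof -
    obtain r where r: "hausdorff_measure s X = ennreal r" "r \<ge> 0"
      using assms(3) by (cases "hausdorff_measure s X") auto
    then show ?thesis
      using that[of "r + 1"] by (simp add: ennreal_lessI)
  qed
  have bound: "hausdorff_premeasure t \<epsilon> X \<le> ennreal (\<epsilon> powr (t - s) * K)" if "\<epsilon> > 0" for \<epsilon>
  proof -
    have "hausdorff_premeasure s \<epsilon> X < ennreal K"
      using hausdorff_premeasure_le_measure[OF that] K(2) by (rule le_less_trans)
    then obtain C :: "nat \<Rightarrow> 'a set" where C: "X \<subseteq> (\<Union>i. C i)" "\<And>i. bounded (C i)"
        "\<And>i. diameter (C i) \<le> \<epsilon>" "(\<Sum>i. diam_pow s (C i)) < ennreal K"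
      by (rule hausdorff_premeasure_lessD) blast
    have "hausdorff_premeasure t \<epsilon> X \<le> (\<Sum>i. diam_pow t (C i))"
      using C by (intro hausdorff_premeasure_le)
    also have "\<dots> \<le> (\<Sum>i. ennreal (\<epsilon> powr (t - s)) * diam_pow s (C i))"
      using C that assms by (intro suminf_le diam_pow_le_mult summableI) auto
    also have "\<dots> = ennreal (\<epsilon> powr (t - s)) * (\<Sum>i. diam_pow s (C i))"
      by simp
    also have "\<dots> \<le> ennreal (\<epsilon> powr (t - s)) * ennreal K"
      using C(4) by (intro mult_left_mono) auto
    finally show ?thesis
      using K(1) by (simp add: ennreal_mult)
  qed
  have "hausdorff_premeasure t \<delta> X \<le> ennreal e" if "\<delta> > 0" "e > 0" for \<delta> e
  proof -
    \<comment> \<open>The second entry solves \<open>\<epsilon> powr (t - s) * K = e\<close>; the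
      minimum with \<open>\<delta>\<close> keeps covers of mesh \<open>\<epsilon>\<close> admissible
      at scale \<open>\<delta>\<close>.\<close>
    define \<epsilon> where "\<epsilon> = min \<delta> ((e / K) powr (1 / (t - s)))"
    have "\<epsilon> > 0"
      using that K(1) by (simp add: \<epsilon>_def)
    have "\<epsilon> powr (t - s) \<le> ((e / K) powr (1 / (t - s))) powr (t - s)"
      using \<open>\<epsilon> > 0\<close> assms by (intro powr_mono2) (auto simp: \<epsilon>_def)
    also have "\<dots> = e / K"
      using assms that K(1) by (simp add: powr_powr)
    finally have "\<epsilon> powr (t - s) * K \<le> e"
      using K(1) by (simp add: field_simps)
    moreover have "hausdorff_premeasure t \<delta> X \<le> hausdorff_premeasure t \<epsilon> X"
      by (intro hausdorff_premeasure_antimono) (simp add: \<epsilon>_def)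
    ultimately show ?thesis
      using bound[OF \<open>\<epsilon> > 0\<close>] by (simp add: ennreal_leI order.trans)
  qed
  then show ?thesis
    by (rule hausdorff_measure_eq_0I)
qed

lemma hausdorff_measure_UN_null:
  fixes A :: "nat \<Rightarrow> 'a::metric_space set"
  assumes "\<And>i. hausdorff_measure t (A i) = 0"
  shows "hausdorff_measure t (\<Union>i. A i) = 0"
proof -
  have "hausdorff_premeasure t \<delta> (\<Union>i. A i) \<le> ennreal e" if "\<delta> > 0" "e > 0" for \<delta> e
  proof -
    have "\<exists>C :: nat \<Rightarrow> 'a set. A i \<subseteq> (\<Union>j. C j) \<and> (\<forall>j. bounded (C j) \<and> diameter (C j) \<le> \<delta>) \<and>
            (\<Sum>j. diam_pow t (C j)) < ennreal (e * (1/2) ^ Suc i)" for i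
    proof -
      have "hausdorff_premeasure t \<delta> (A i) \<le> 0"
        using hausdorff_premeasure_le_measure[OF \<open>\<delta> > 0\<close>] assms by metis
      then have "hausdorff_premeasure t \<delta> (A i) < ennreal (e * (1/2) ^ Suc i)"
        using \<open>e > 0\<close> by simp
      then show ?thesis
        by (rule hausdorff_premeasure_lessD) blast
    qed
    then obtain C :: "nat \<Rightarrow> nat \<Rightarrow> 'a set" where C: "\<And>i. A i \<subseteq> (\<Union>j. C i j)"
        "\<And>i j. bounded (C i j)" "\<And>i j. diameter (C i j) \<le> \<delta>"
        "\<And>i. (\<Sum>j. diam_pow t (C i j)) < ennreal (e * (1/2) ^ Suc i)"
      by metis
    \<comment> \<open>The covers of all \<open>A i\<close>, where the \<open>i\<close>-th has a sum
      below \<open>e / 2 ^ (i + 1)\<close>, are merged into one sequence by the pairing function;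
      the budgets add up to \<open>e\<close>.\<close>
    define D where "D = (\<lambda>k. case_prod C (prod_decode k))"
    have "(\<Union>i. A i) \<subseteq> (\<Union>k. D k)"
    proof
      fix x assume "x \<in> (\<Union>i. A i)"
      then obtain i j where "x \<in> C i j"
        using C(1) by blast
      then have "x \<in> D (prod_encode (i, j))"
        by (simp add: D_def)
      then show "x \<in> (\<Union>k. D k)"
        by blast
    qed
    then have "hausdorff_premeasure t \<delta> (\<Union>i. A i) \<le> (\<Sum>k. diam_pow t (D k))"
      using C by (intro hausdorff_premeasure_le) (auto simp: D_def split: prod.split)
    also have "\<dots> = (\<Sum>k. (\<lambda>p. diam_pow t (case_prod C p)) (prod_decode k))"
      by (simp add: D_def)
    also have "\<dots> = (\<Sum>i. \<Sum>j. diam_pow t (C i j))"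
      by (rule suminf_ennreal_2dimen) simp
    also have "\<dots> \<le> (\<Sum>i. ennreal (e * (1/2) ^ Suc i))"
      using C(4) by (intro suminf_le summableI) (auto intro: less_imp_le)
    also have "\<dots> = ennreal (e * 1)"
      using \<open>e > 0\<close>
      by (intro sums_unique[symmetric] sums_ennreal[THEN iffD2] sums_mult power_half_series) auto
    finally show ?thesis by simp
  qed
  then show ?thesis
    by (rule hausdorff_measure_eq_0I)
qed

section \<open>Hausdorff dimension as a critical exponent, and its countable stability\<close>

lemma hausdorff_dim_empty [simp]: "hausdorff_dim {} = -1"
  by (simp add: hausdorff_dim_def)

lemma hausdorff_dim_nonneg: "X \<noteq> {} \<Longrightarrow> hausdorff_dim X \<ge> 0"
  by (auto simp: hausdorff_dim_def intro!: Inf_greatest)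

lemma hausdorff_dim_ge: "hausdorff_dim X \<ge> -1"
  using hausdorff_dim_nonneg[of X] by (cases "X = {}") (auto intro: order_trans[of _ 0])

lemma hausdorff_dim_mono:
  assumes "X \<subseteq> Y"
  shows "hausdorff_dim X \<le> hausdorff_dim Y"
proof (cases "X = {}")
  case True
  then show ?thesis
    by (simp add: hausdorff_dim_ge)
next
  case False
  then show ?thesis
    using assms hausdorff_measure_mono[OF assms]
    by (auto simp: hausdorff_dim_def intro!: Inf_superset_mono intro: le_less_trans)
qed

text \<open>Finiteness of the measure is not preserved by countable unions, but nullity is. Each
  real exponent above \<open>c\<close> exceeds an exponent of finite measure for every nonempty
  \<open>A i\<close>, so all the pieces are null there.\<close>

lemma hausdorff_dim_UN_le:
  fixes A :: "nat \<Rightarrow> 'a::metric_space set"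
  assumes "\<And>i. hausdorff_dim (A i) \<le> c"
  shows "hausdorff_dim (\<Union>i. A i) \<le> c"
proof (cases "(\<Union>i. A i) = {}")
  case True
  then show ?thesis
    using order_trans[OF hausdorff_dim_ge assms] by simp
next
  case False
  \<comment> \<open>A nonempty piece has dimension at least 0. Hence \<open>0 \<le> c\<close>, and
    every real \<open>t > c\<close> is an admissible exponent.\<close>
  then obtain j where "A j \<noteq> {}" by blast
  then have "0 \<le> c"
    using hausdorff_dim_nonneg assms order_trans by blast
  show ?thesis
  proof (rule dense_ge)
    fix t assume "c < t"
    show "hausdorff_dim (\<Union>i. A i) \<le> t"
    proof (cases t)
      case (real r)
      have "hausdorff_measure r (A i) = 0" for i
      proof (cases "A i = {}")
        case nonempty: False
        then have "Inf {ereal s | s. 0 \<le> s \<and> hausdorff_measure s (A i) < \<infinity>} < ereal r"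
          using assms[of i] \<open>c < t\<close> real by (simp add: hausdorff_dim_def)
        then obtain s where "0 \<le> s" "s < r" "hausdorff_measure s (A i) < \<infinity>"
          unfolding Inf_less_iff by auto
        then show ?thesis
          by (rule hausdorff_measure_eq_0_above)
      qed simp
      then have "hausdorff_measure r (\<Union>i. A i) = 0"
        by (rule hausdorff_measure_UN_null)
      moreover have "0 \<le> r"
        using \<open>0 \<le> c\<close> \<open>c < t\<close> real by (metis ereal_less_eq(5) less_imp_le order_trans)
      ultimately show ?thesis
        using False real by (auto simp: hausdorff_dim_def intro!: Inf_lower)
    qed (use \<open>0 \<le> c\<close> \<open>c < t\<close> in auto)
  qed
qed

lemma hausdorff_dim_countable_UN_le:
  assumes "countable I" "I \<noteq> {}" "\<And>i. i \<in> I \<Longrightarrow> hausdorff_dim (A i) \<le> c"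
  shows "hausdorff_dim (\<Union>i\<in>I. A i) \<le> c"
proof -
  have "(\<Union>i\<in>I. A i) = (\<Union>n. A (from_nat_into I n))"
    using range_from_nat_into[OF assms(2,1)] by (metis image_image)
  then show ?thesis
    using assms by (simp add: from_nat_into hausdorff_dim_UN_le)
qed

section \<open>Separable metric spaces and open bases\<close>

text \<open>Balls of radius \<open>1 / (n + 1)\<close> about the points of a countable dense set
  form a basis. Second countability is the form that passes to subspaces and yields the Lindelof
  property.\<close>

lemma separable_imp_second_countable:
  fixes X :: "'a::metric_space set"
  assumes "separable_space (top_of_set X)"
  shows "second_countable (top_of_set X)"
proof -
  obtain C where C: "countable C" "C \<subseteq> X" "top_of_set X closure_of C = X"
    using assms by (auto simp: separable_space_def)
  have dense: "\<exists>c\<in>C. dist c x < e" if "x \<in> X" "e > 0" for x e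
  proof -
    have "x \<in> top_of_set X closure_of C"
      using C(3) that(1) by simp
    moreover have "openin (top_of_set X) (X \<inter> ball x e)" "x \<in> X \<inter> ball x e"
      using that by (simp_all add: openin_open_Int)
    ultimately have "\<exists>c. c \<in> C \<and> c \<in> X \<inter> ball x e"
      unfolding in_closure_of by blast
    then show ?thesis
      by (auto simp: dist_commute)
  qed
  define \<B> where "\<B> = (\<lambda>(c, n). X \<inter> ball c (inverse (real (Suc n)))) ` (C \<times> UNIV)"
  have "countable \<B>"
    using C(1) by (simp add: \<B>_def)
  moreover have "openin (top_of_set X) V" if "V \<in> \<B>" for V
    using that by (auto simp: \<B>_def openin_open_Int)
  moreover have "\<exists>V\<in>\<B>. x \<in> V \<and> V \<subseteq> U" if "openin (top_of_set X) U" "x \<in> U" for U x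
  proof -
    obtain e where e: "e > 0" "ball x e \<inter> X \<subseteq> U"
      using \<open>openin (top_of_set X) U\<close> \<open>x \<in> U\<close> by (auto simp: openin_contains_ball)
    have "x \<in> X"
      using that openin_imp_subset by blast
    obtain n where n: "inverse (real (Suc n)) < e / 2"
      using e(1) reals_Archimedean[of "e / 2"] by auto
    obtain c where c: "c \<in> C" "dist c x < inverse (real (Suc n))"
      using dense[OF \<open>x \<in> X\<close>, of "inverse (real (Suc n))"] by auto
    have "X \<inter> ball c (inverse (real (Suc n))) \<subseteq> U"
    proof
      fix y assume y: "y \<in> X \<inter> ball c (inverse (real (Suc n)))"
      then have "dist x y < e"
        using n c(2) dist_triangle3[of x y c] by simp
      then show "y \<in> U"
        using y e(2) by auto
    qed
    then show ?thesis
      using c \<open>x \<in> X\<close> by (auto simp: \<B>_def intro!: bexI[of _ "(c, n)"])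
  qed
  ultimately show ?thesis
    unfolding second_countable_def by (intro exI[of _ \<B>]) simp
qed

text \<open>Bounds on boundaries are known only for members of the given basis, so the countable
  basis has to be extracted from it. For each pair \<open>(C, D)\<close> from some countable basis,
  one member of \<open>\<B>\<close> between \<open>C\<close> and \<open>D\<close> is chosen, if
  there is any.\<close>

lemma countable_subbasis:
  assumes "second_countable T" "is_open_basis T \<B>"
  obtains \<B>' where "countable \<B>'" "\<B>' \<subseteq> \<B>" "is_open_basis T \<B>'"
proof -
  obtain \<C> where \<C>: "countable \<C>" "\<And>V. V \<in> \<C> \<Longrightarrow> openin T V"
    "\<And>U x. openin T U \<Longrightarrow> x \<in> U \<Longrightarrow> \<exists>V\<in>\<C>. x \<in> V \<and> V \<subseteq> U"
    using assms(1) by (auto simp: second_countable_def)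
  define P where "P = (\<lambda>(C, D) U. U \<in> \<B> \<and> C \<subseteq> U \<and> U \<subseteq> D)"
  define I where "I = {p \<in> \<C> \<times> \<C>. \<exists>U. P p U}"
  define \<B>' where "\<B>' = (\<lambda>p. SOME U. P p U) ` I"
  have P: "P p (SOME U. P p U)" if "p \<in> I" for p
    using that by (auto simp: I_def intro: someI)
  have "countable \<B>'"
    unfolding \<B>'_def I_def using \<C>(1) by (intro countable_image countable_Collect) auto
  moreover have sub: "\<B>' \<subseteq> \<B>"
    using P by (auto simp: \<B>'_def P_def)
  moreover have "\<exists>U\<in>\<B>'. x \<in> U \<and> U \<subseteq> V" if V: "openin T V" "x \<in> V" for V x
  proof -
    obtain D where D: "D \<in> \<C>" "x \<in> D" "D \<subseteq> V"
      using \<C>(3)[OF V] by blast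
    then obtain U where U: "U \<in> \<B>" "x \<in> U" "U \<subseteq> D"
      using assms(2) \<C>(2) unfolding is_open_basis_def by meson
    then obtain C where C: "C \<in> \<C>" "x \<in> C" "C \<subseteq> U"
      using assms(2) \<C>(3) unfolding is_open_basis_def by meson
    \<comment> \<open>The set chosen for \<open>(C, D)\<close> may differ from \<open>U\<close>, but
      it still contains \<open>x\<close>, since \<open>C\<close> does, and lies in \<open>V\<close>,
      since \<open>D\<close> does.\<close>
    have "(C, D) \<in> I"
      using C D U by (auto simp: I_def P_def)
    then show ?thesis
      using P[of "(C, D)"] C D unfolding \<B>'_def P_def by blast
  qed
  moreover have "\<forall>U\<in>\<B>'. openin T U"
    using sub assms(2) by (auto simp: is_open_basis_def)
  ultimately show ?thesis
    by (intro that) (auto simp: is_open_basis_def)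
qed

section \<open>Elementary facts on open bases, and boundaries in subspaces\<close>

lemma is_open_basis_nonempty:
  assumes "is_open_basis T \<B>" "topspace T \<noteq> {}"
  shows "\<B> \<noteq> {}"
proof -
  obtain x where "x \<in> topspace T"
    using assms(2) by blast
  then have "\<exists>U\<in>\<B>. x \<in> U"
    using assms(1) openin_topspace unfolding is_open_basis_def by metis
  then show ?thesis
    by blast
qed

lemma is_open_basis_superset:
  assumes "is_open_basis T \<B>" "\<B> \<subseteq> \<B>'" "\<And>U. U \<in> \<B>' \<Longrightarrow> openin T U"
  shows "is_open_basis T \<B>'"
  using assms unfolding is_open_basis_def by (meson subsetD)

lemma is_open_basis_subtopology:
  assumes "is_open_basis T \<B>"
  shows "is_open_basis (subtopology T S) ((\<lambda>U. S \<inter> U) ` \<B>)"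
  unfolding is_open_basis_def
proof (intro conjI allI impI ballI)
  fix W assume "W \<in> (\<lambda>U. S \<inter> U) ` \<B>"
  then show "openin (subtopology T S) W"
    using assms by (auto simp: is_open_basis_def intro: openin_subtopology_Int2)
next
  fix V x assume "openin (subtopology T S) V \<and> x \<in> V"
  then obtain W where W: "openin T W" "V = W \<inter> S" "x \<in> W" "x \<in> S"
    by (auto simp: openin_subtopology)
  then obtain U where "U \<in> \<B>" "x \<in> U" "U \<subseteq> W"
    using assms unfolding is_open_basis_def by meson
  then show "\<exists>U\<in>(\<lambda>U. S \<inter> U) ` \<B>. x \<in> U \<and> U \<subseteq> V"
    using W by (intro bexI[of _ "S \<inter> U"]) auto
qed

text \<open>In a subspace, closures of traces can only shrink and interiors can only grow, so
  boundaries shrink. This carries dimension bounds to subspaces and makes traces clopen away from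
  the boundaries.\<close>

lemma frontier_of_subtopology_Int_subset:
  "subtopology T S frontier_of (S \<inter> U) \<subseteq> S \<inter> (T frontier_of U)"
proof -
  have "subtopology T S closure_of (S \<inter> U) \<subseteq> S \<inter> T closure_of U"
    by (metis Int_lower2 Int_left_absorb closure_of_mono closure_of_subtopology inf.boundedI
        inf_le1 order_trans)
  moreover have "S \<inter> T interior_of U \<subseteq> subtopology T S interior_of (S \<inter> U)"
    by (intro interior_of_maximal) (auto intro: openin_subtopology_Int2 dest: subsetD[OF interior_of_subset])
  ultimately show ?thesis
    unfolding frontier_of_def by blast
qed

section \<open>Zero-dimensional spaces\<close>

lemma dimension_le_0_iff_clopen_basis:
  "T dim_le 0 \<longleftrightarrow> is_open_basis T {U. closedin T U \<and> openin T U}"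
  unfolding dimension_le_0_neighbourhood_base_of_clopen is_open_basis_def
  by (subst open_neighbourhood_base_of) (simp, auto)

text \<open>
  Disjointify a countable cover by clopen sets each of which misses \<open>E\<close> or \<open>F\<close>, and collect the
  pieces missing \<open>F\<close>.
\<close>

lemma Lindelof_zero_dimensional_separation:
  assumes "Lindelof_space T" "T dim_le 0" "closedin T E" "closedin T F" "disjnt E F"
  obtains P where "closedin T P" "openin T P" "E \<subseteq> P" "disjnt P F"
proof (cases "topspace T = {}")
  case True
  then have "E = {}" "F = {}"
    using assms(3,4) closedin_subset by blast+
  then show ?thesis
    using that[of "{}"] by simp
next
  case False
  define \<U> where "\<U> = {U. closedin T U \<and> openin T U \<and> (disjnt U E \<or> disjnt U F)}"
  have cov: "\<exists>U\<in>\<U>. x \<in> U" if x: "x \<in> topspace T" for x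
  proof -
    \<comment> \<open>\<open>G\<close> is one of \<open>E\<close> and \<open>F\<close> that does not
      contain \<open>x\<close>; a clopen neighbourhood of \<open>x\<close> is taken inside its
      complement.\<close>
    define G where "G = (if x \<in> E then F else E)"
    have "openin T (topspace T - G)" "x \<in> topspace T - G"
      using assms x by (auto simp: G_def disjnt_iff)
    then obtain U where "closedin T U" "openin T U" "x \<in> U" "U \<subseteq> topspace T - G"
      using assms(2) unfolding dimension_le_0_iff_clopen_basis is_open_basis_def by blast
    then show ?thesis
      by (auto simp: \<U>_def G_def disjnt_iff split: if_splits)
  qed
  have "\<Union>\<U> = topspace T"
    using cov by (auto simp: \<U>_def dest: openin_subset)
  moreover have "openin T U" if "U \<in> \<U>" for U
    using that by (simp add: \<U>_def)
  ultimately obtain \<V> where \<V>: "countable \<V>" "\<V> \<subseteq> \<U>" "\<Union>\<V> = topspace T"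
    using Lindelof_spaceD[OF assms(1), of \<U>] by metis
  have "\<V> \<noteq> {}"
    using \<V>(3) False by (metis Union_empty)
  define W where "W = from_nat_into \<V>"
  have rW: "range W = \<V>"
    using \<open>\<V> \<noteq> {}\<close> \<V>(1) by (simp add: W_def)
  then have W: "closedin T (W n)" "openin T (W n)" "disjnt (W n) E \<or> disjnt (W n) F" for n
    using \<V>(2) by (auto simp: \<U>_def)
  define D where "D = disjointed W"
  have clD: "closedin T (D n)" "openin T (D n)" for n
    unfolding D_def disjointed_def using W
    by (auto intro!: closedin_Union)
  have UD: "(\<Union>n. D n) = topspace T"
    using rW \<V>(3) by (simp add: D_def UN_disjointed_eq)
  have disj: "n = m" if "x \<in> D n" "x \<in> D m" for x n m
    using disjoint_family_disjointed[of W] that by (auto simp: D_def disjoint_family_on_def)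
  define P where "P = (\<Union>n\<in>{n. disjnt (D n) F}. D n)"
  \<comment> \<open>The \<open>D n\<close> partition the space, so the complement of
    \<open>P\<close> is again a union of open pieces. This makes \<open>P\<close> closed although
    the union may be infinite.\<close>
  have "topspace T - P = (\<Union>n\<in>{n. \<not> disjnt (D n) F}. D n)"
    using UD disj by (auto simp: P_def) blast+
  then have "openin T (topspace T - P)"
    using clD by auto
  moreover have "openin T P"
    using clD by (auto simp: P_def)
  moreover have "E \<subseteq> P"
  proof
    fix x assume "x \<in> E"
    then obtain n where "x \<in> D n"
      using UD assms(3) closedin_subset by blast
    then have "\<not> disjnt (W n) E"
      using \<open>x \<in> E\<close> disjointed_subset[of W n] by (auto simp: D_def disjnt_iff)
    then have "disjnt (D n) F"
      using W(3) disjointed_subset[of W n] by (auto simp: D_def disjnt_iff)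
    then show "x \<in> P"
      using \<open>x \<in> D n\<close> by (auto simp: P_def)
  qed
  moreover have "disjnt P F"
    by (auto simp: P_def disjnt_iff)
  ultimately show ?thesis
    using that by (simp add: closedin_def openin_subset)
qed

text \<open>The inductive step of the sum theorem. A clopen subset \<open>P\<close> of
  \<open>Z\<close> splits \<open>Z\<close> between the two sides; as \<open>Z\<close> is closed in
  \<open>T\<close>, both enlarged sets are closed and disjoint, and normality thickens them to
  closed neighbourhoods.\<close>

lemma closed_separation_step:
  assumes "normal_space T" "closedin T Z" "Lindelof_space (subtopology T Z)"
    "subtopology T Z dim_le 0" "closedin T E" "closedin T F" "disjnt E F"
  shows "\<exists>E' F'. closedin T E' \<and> closedin T F' \<and> disjnt E' F' \<and>
           E \<subseteq> T interior_of E' \<and> F \<subseteq> T interior_of F' \<and> Z \<subseteq> E' \<union> F'"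
proof -
  have "closedin (subtopology T Z) (E \<inter> Z)" "closedin (subtopology T Z) (F \<inter> Z)"
    using assms by (auto simp: closedin_subtopology)
  moreover have "disjnt (E \<inter> Z) (F \<inter> Z)"
    using assms(7) by (auto simp: disjnt_iff)
  ultimately obtain P where P: "closedin (subtopology T Z) P" "openin (subtopology T Z) P"
      "E \<inter> Z \<subseteq> P" "disjnt P (F \<inter> Z)"
    using Lindelof_zero_dimensional_separation assms(3,4) by metis
  have PZ: "P \<subseteq> Z" "Z \<subseteq> topspace T"
    using closedin_imp_subset[OF P(1)] closedin_subset[OF assms(2)] by simp_all
  have "closedin (subtopology T Z) (Z - P)"
    using P(2) PZ by (simp add: closedin_def double_diff Int_absorb1)
  then have "closedin T P" "closedin T (Z - P)"
    using closedin_trans_full[OF _ assms(2)] P(1) by simp_all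
  then have cl: "closedin T (E \<union> P)" "closedin T (F \<union> (Z - P))"
    using assms by auto
  have "disjnt (E \<union> P) (F \<union> (Z - P))"
    using P assms(7) PZ by (auto simp: disjnt_iff)
  \<comment> \<open>Normality is used twice: first to keep the closure of \<open>U\<close> off the
    other closed set, then to separate that closure from the closure of a neighbourhood
    \<open>V\<close> of this set.\<close>
  then obtain U where U: "openin T U" "E \<union> P \<subseteq> U" "disjnt (F \<union> (Z - P)) (T closure_of U)"
    using assms(1) cl unfolding normal_space by meson
  have "disjnt (T closure_of U) (F \<union> (Z - P))"
    using U(3) by (simp add: disjnt_sym)
  then obtain V where V: "openin T V" "F \<union> (Z - P) \<subseteq> V" "disjnt (T closure_of U) (T closure_of V)"
    using assms(1) cl(2) closedin_closure_of[of T U] unfolding normal_space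
    by (metis disjnt_sym)
  have "U \<subseteq> T closure_of U" "V \<subseteq> T closure_of V"
    using U V by (simp_all add: closure_of_subset openin_subset)
  then have "U \<subseteq> T interior_of (T closure_of U)" "V \<subseteq> T interior_of (T closure_of V)"
    using U V by (simp_all add: interior_of_maximal)
  then show ?thesis
    using U(2) V(2,3) \<open>U \<subseteq> T closure_of U\<close> \<open>V \<subseteq> T closure_of V\<close>
    by (intro exI[of _ "T closure_of U"] exI[of _ "T closure_of V"] conjI) (simp_all, blast+)
qed

text \<open>The separation step is iterated, and stage \<open>n\<close> absorbs \<open>Z n\<close>
  into the growing disjoint pair.\<close>

lemma zero_dimensional_sum_separation:
  fixes Z :: "nat \<Rightarrow> 'a set"
  assumes T: "normal_space T" "topspace T = (\<Union>n. Z n)"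
    and Z: "\<And>n. closedin T (Z n)" "\<And>n. Lindelof_space (subtopology T (Z n))"
      "\<And>n. subtopology T (Z n) dim_le 0"
    and EF: "closedin T E" "closedin T F" "disjnt E F"
  obtains U V where "openin T U" "openin T V" "E \<subseteq> U" "F \<subseteq> V" "disjnt U V" "U \<union> V = topspace T"
proof -
  \<comment> \<open>\<open>P\<close> is the invariant of the recursion, and its clause for
    \<open>n = 0\<close> pins the starting pair to \<open>(E, F)\<close>; \<open>Q\<close> relates
    consecutive stages.\<close>
  define P where "P = (\<lambda>n (A, B). closedin T A \<and> closedin T B \<and> disjnt A B \<and>
                         ((n::nat) = 0 \<longrightarrow> A = E \<and> B = F))"
  define Q where "Q = (\<lambda>n (A, B) (A', B'). A \<subseteq> T interior_of A' \<and> B \<subseteq> T interior_of B' \<and>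
                         Z n \<subseteq> A' \<union> B')"
  have "\<exists>g. \<forall>n. P n (g n) \<and> Q n (g n) (g (Suc n))"
  proof (rule dependent_nat_choice)
    show "\<exists>x. P 0 x"
      using EF by (auto simp: P_def)
    fix x n assume "P n x"
    then show "\<exists>y. P (Suc n) y \<and> Q n x y"
      using closed_separation_step[OF T(1) Z, of "fst x" "snd x" n]
      by (auto simp: P_def Q_def split: prod.splits)
  qed
  then obtain g where g: "\<And>n. P n (g n)" "\<And>n. Q n (g n) (g (Suc n))"
    by blast
  define A where "A = (\<lambda>n. fst (g n))"
  define B where "B = (\<lambda>n. snd (g n))"
  have AB: "disjnt (A n) (B n)" "A 0 = E" "B 0 = F" for n
    using g(1)[of n] g(1)[of 0] by (auto simp: P_def A_def B_def split: prod.splits)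
  have step: "A n \<subseteq> T interior_of A (Suc n)" "B n \<subseteq> T interior_of B (Suc n)"
      "Z n \<subseteq> A (Suc n) \<union> B (Suc n)" for n
    using g(2)[of n] by (auto simp: Q_def A_def B_def split: prod.splits)
  have "A n \<subseteq> A (Suc n)" "B n \<subseteq> B (Suc n)" for n
    using step(1,2)[of n] interior_of_subset[of T "A (Suc n)"] interior_of_subset[of T "B (Suc n)"]
    by simp_all
  then have mono: "A m \<subseteq> A n" "B m \<subseteq> B n" if "m \<le> n" for m n
    using that by (simp_all add: lift_Suc_mono_le)
  \<comment> \<open>Interiors make the unions open. They still contain every stage, because each
    stage lies in the interior of the next.\<close>
  define U where "U = (\<Union>n. T interior_of A n)"
  define V where "V = (\<Union>n. T interior_of B n)"
  have sub: "A n \<subseteq> U" "B n \<subseteq> V" for n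
    using step[of n] by (auto simp: U_def V_def)
  have "disjnt U V"
  proof -
    have "disjnt (A n) (B m)" for n m
      using mono(1)[of n "max n m"] mono(2)[of m "max n m"] AB(1)[of "max n m"]
      unfolding disjnt_iff by (metis max.cobounded1 max.cobounded2 subsetD)
    then have "disjnt (T interior_of A n) (T interior_of B m)" for n m
      by (meson disjnt_subset1 disjnt_subset2 interior_of_subset)
    then show ?thesis
      by (auto simp: U_def V_def disjnt_iff)
  qed
  moreover have "openin T U" "openin T V"
    by (auto simp: U_def V_def)
  moreover have "U \<union> V = topspace T"
  proof
    show "U \<union> V \<subseteq> topspace T"
      using \<open>openin T U\<close> \<open>openin T V\<close> by (simp add: openin_subset)
    show "topspace T \<subseteq> U \<union> V"
      using T(2) step(3) sub by blast
  qed
  ultimately show ?thesis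
    using that sub[of 0] AB(2,3) by blast
qed

text \<open>
  A partition of the subspace \<open>Y\<close> extends to \<open>T\<close> since the two enlarged sets are separated:
  \<open>P\<close> stays away from a neighbourhood of \<open>F\<close> and \<open>Q\<close> from a neighbourhood of \<open>E\<close>.
\<close>

lemma zero_dimensional_sum_subspace_separation:
  fixes Z :: "nat \<Rightarrow> 'a set"
  assumes T: "metrizable_space T"
    and Y: "Y \<subseteq> topspace T" "Y = (\<Union>n. Z n)"
    and Z: "\<And>n. closedin (subtopology T Y) (Z n)" "\<And>n. Lindelof_space (subtopology T (Z n))"
      "\<And>n. subtopology T (Z n) dim_le 0"
    and EF: "closedin T E" "closedin T F" "disjnt E F"
  obtains U V where "openin T U" "openin T V" "E \<subseteq> U" "F \<subseteq> V" "disjnt U V" "Y \<subseteq> U \<union> V"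
proof -
  have norm: "normal_space T"
    by (rule metrizable_imp_normal_space[OF T])
  \<comment> \<open>Separating only the traces of \<open>E\<close> and \<open>F\<close> on
    \<open>Y\<close> would allow a side to accumulate at a point of \<open>E\<close> or
    \<open>F\<close> outside \<open>Y\<close>; neighbourhoods with disjoint closures prevent
    this.\<close>
  obtain G where G: "openin T G" "E \<subseteq> G" "disjnt F (T closure_of G)"
    using norm EF unfolding normal_space by metis
  obtain H where H: "openin T H" "F \<subseteq> H" "disjnt (T closure_of G) (T closure_of H)"
    using norm EF(2) G(3) closedin_closure_of[of T G] unfolding normal_space by metis
  let ?Y = "subtopology T Y"
  have "subtopology ?Y (Z n) = subtopology T (Z n)" for n
    using Y(2) by (simp add: subtopology_subtopology Int_absorb1 UN_upper)
  moreover have "normal_space ?Y"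
    by (intro metrizable_imp_normal_space metrizable_space_subtopology T)
  moreover have "topspace ?Y = (\<Union>n. Z n)"
    using Y by (simp add: Int_absorb1)
  moreover have "closedin ?Y (Y \<inter> T closure_of G)" "closedin ?Y (Y \<inter> T closure_of H)"
    by (auto intro: closedin_subtopology_Int_closed)
  moreover have "disjnt (Y \<inter> T closure_of G) (Y \<inter> T closure_of H)"
    using H(3) by (auto simp: disjnt_iff)
  ultimately obtain P Q where PQ: "openin ?Y P" "openin ?Y Q" "Y \<inter> T closure_of G \<subseteq> P"
      "Y \<inter> T closure_of H \<subseteq> Q" "disjnt P Q" "P \<union> Q = Y"
    using zero_dimensional_sum_separation[of ?Y Z] Z Y(2) by metis
  obtain P' Q' where P': "openin T P'" "P = P' \<inter> Y" and Q': "openin T Q'" "Q = Q' \<inter> Y"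
    using PQ(1,2) by (auto simp: openin_subtopology)
  have GH: "G \<subseteq> T closure_of G" "H \<subseteq> T closure_of H"
    using G H by (simp_all add: closure_of_subset openin_subset)
  have avoid: "disjnt W (T closure_of S)" if "openin T W" "disjnt W S" for W S
    using that openin_Int_closure_of_eq_empty[of T W S] by (simp add: disjnt_def)
  \<comment> \<open>The extensions \<open>P'\<close> and \<open>Q'\<close> may meet outside
    \<open>Y\<close>. However, \<open>Q'\<close> is open and misses \<open>P\<close>, so it misses
    the closure of \<open>P\<close>; the other three pairs are treated alike.\<close>
  have "disjnt Q' P" "disjnt P' Q" "disjnt H P" "disjnt G Q"
    using PQ(3-6) P'(2) Q'(2) GH by (auto simp only: disjnt_iff)
  then have "disjnt Q' (T closure_of P)" "disjnt P' (T closure_of Q)"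
      "disjnt H (T closure_of P)" "disjnt G (T closure_of Q)"
    using avoid P' Q' G H by blast+
  then have "disjnt (F \<union> Q) (T closure_of P)" "disjnt (E \<union> P) (T closure_of Q)"
    using G(2) H(2) P'(2) Q'(2) unfolding disjnt_iff by blast+
  moreover have "disjnt Q E" "disjnt P F"
    using PQ(3-6) G(2) H(2) GH unfolding disjnt_iff by blast+
  ultimately have "separatedin T (E \<union> P) (F \<union> Q)"
    using EF Y(1) PQ(6) closedin_subset[OF EF(1)] closedin_subset[OF EF(2)]
    unfolding separatedin_def closure_of_Un closure_of_closedin[OF EF(1)] closure_of_closedin[OF EF(2)]
      disjnt_iff
    by blast
  \<comment> \<open>Metrizable spaces are completely normal: separated sets, closed or not, have
    disjoint open neighbourhoods.\<close>
  then obtain U V where "openin T U" "openin T V" "E \<union> P \<subseteq> U" "F \<union> Q \<subseteq> V" "disjnt U V"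
    using metrizable_space_separation[OF T] by metis
  then show ?thesis
    using that PQ(6) by blast
qed

section \<open>Countable stability\<close>

lemma top_hausdorff_dim_basis_bound_ge:
  assumes "is_open_basis (top_of_set X) \<B>" "X \<noteq> {}"
    "\<And>U. U \<in> \<B> \<Longrightarrow> hausdorff_dim (top_of_set X frontier_of U) \<le> d - 1"
  shows "d \<ge> (0::ereal)"
proof -
  obtain U where "U \<in> \<B>"
    using is_open_basis_nonempty[OF assms(1)] assms(2) by auto
  then have "-1 \<le> d - 1"
    using assms(3) hausdorff_dim_ge order_trans by blast
  then show ?thesis
    by (cases d) (auto simp: one_ereal_def)
qed

lemma top_hausdorff_dim_nonneg:
  assumes "X \<noteq> {}"
  shows "top_hausdorff_dim X \<ge> 0"
proof -
  have "0 \<le> d" if "\<exists>\<B>. is_open_basis (top_of_set X) \<B> \<and>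
      (\<forall>U\<in>\<B>. hausdorff_dim (top_of_set X frontier_of U) \<le> d - 1)" for d
    using that top_hausdorff_dim_basis_bound_ge[OF _ assms] by metis
  then show ?thesis
    unfolding top_hausdorff_dim_def if_not_P[OF assms] by (intro Inf_greatest) simp
qed

text \<open>The traces on \<open>Y\<close> of a basis of \<open>X\<close> form a basis with smaller
  boundaries, so every bound admissible for \<open>X\<close> is admissible for
  \<open>Y\<close>.\<close>

lemma top_hausdorff_dim_mono:
  assumes "Y \<subseteq> X"
  shows "top_hausdorff_dim Y \<le> top_hausdorff_dim X"
proof (cases "Y = {}")
  case True
  have "-1 \<le> top_hausdorff_dim X"
    using top_hausdorff_dim_nonneg[of X]
    by (cases "X = {}") (auto simp: top_hausdorff_dim_def intro: order_trans[of _ 0])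
  then show ?thesis
    using True by (simp add: top_hausdorff_dim_def)
next
  case False
  have "\<exists>\<B>'. is_open_basis (top_of_set Y) \<B>' \<and>
          (\<forall>U\<in>\<B>'. hausdorff_dim (top_of_set Y frontier_of U) \<le> d - 1)"
    if \<B>: "is_open_basis (top_of_set X) \<B>"
      "\<forall>U\<in>\<B>. hausdorff_dim (top_of_set X frontier_of U) \<le> d - 1" for \<B> d
  proof (intro exI conjI ballI)
    have YX: "subtopology (top_of_set X) Y = top_of_set Y"
      using assms by (simp add: subtopology_subtopology Int_absorb1)
    show "is_open_basis (top_of_set Y) ((\<lambda>U. Y \<inter> U) ` \<B>)"
      using is_open_basis_subtopology[OF \<B>(1), of Y] YX by simp
    fix W assume "W \<in> (\<lambda>U. Y \<inter> U) ` \<B>"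
    then obtain U where U: "U \<in> \<B>" "W = Y \<inter> U"
      by blast
    have "top_of_set Y frontier_of W \<subseteq> top_of_set X frontier_of U"
      using frontier_of_subtopology_Int_subset[of "top_of_set X" Y U] YX U by auto
    then show "hausdorff_dim (top_of_set Y frontier_of W) \<le> d - 1"
      using \<B>(2) U(1) hausdorff_dim_mono order_trans by blast
  qed
  then show ?thesis
    using False assms unfolding top_hausdorff_dim_def
    by (auto intro!: Inf_superset_mono)
qed

text \<open>Countably many boundaries suffice for \<open>A\<close>, so countable stability bounds
  its dimension; off \<open>A\<close> the basis sets have empty boundary and become clopen.\<close>

lemma top_hausdorff_dim_lessD:
  fixes X :: "'a::metric_space set"
  assumes "second_countable (top_of_set X)" "top_hausdorff_dim X < d" "0 \<le> d"
  obtains A where "A \<subseteq> X" "hausdorff_dim A \<le> d - 1" "top_of_set (X - A) dim_le 0"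
proof (cases "X = {}")
  case True
  \<comment> \<open>The empty space is included because some of the closed pieces may be empty;
    \<open>A = {}\<close> then works since \<open>0 \<le> d\<close>.\<close>
  have "-1 \<le> d - 1"
    using assms(3) by (cases d) (auto simp: one_ereal_def)
  then show ?thesis
    using that[of "{}"] True by (simp add: dimension_le_mono[of _ "-1"])
next
  case False
  let ?S = "{d. \<exists>\<B>. is_open_basis (top_of_set X) \<B> \<and>
              (\<forall>U\<in>\<B>. hausdorff_dim (top_of_set X frontier_of U) \<le> d - 1)}"
  have "Inf ?S < d"
    using assms(2) unfolding top_hausdorff_dim_def if_not_P[OF False] .
  then obtain e where "e \<in> ?S" and ed: "e < d"
    unfolding Inf_less_iff by (elim bexE)
  then obtain \<B> where \<B>: "is_open_basis (top_of_set X) \<B>"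
      "\<forall>U\<in>\<B>. hausdorff_dim (top_of_set X frontier_of U) \<le> e - 1"
    by (elim CollectE exE conjE)
  obtain \<C> where \<C>: "countable \<C>" "\<C> \<subseteq> \<B>" "is_open_basis (top_of_set X) \<C>"
    using countable_subbasis[OF assms(1) \<B>(1)] by metis
  have "\<C> \<noteq> {}"
    using is_open_basis_nonempty[OF \<C>(3)] False by simp
  define A where "A = (\<Union>U\<in>\<C>. top_of_set X frontier_of U)"
  have "hausdorff_dim (top_of_set X frontier_of U) \<le> d - 1" if "U \<in> \<C>" for U
  proof -
    have "hausdorff_dim (top_of_set X frontier_of U) \<le> e - 1"
      using \<B>(2) \<C>(2) that by blast
    also have "e - 1 \<le> d - 1"
      using ed by (intro ereal_minus_mono) auto
    finally show ?thesis .
  qed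
  then have "hausdorff_dim A \<le> d - 1"
    unfolding A_def using \<C>(1) \<open>\<C> \<noteq> {}\<close> by (intro hausdorff_dim_countable_UN_le)
  moreover have "A \<subseteq> X"
    using frontier_of_subset_topspace[of "top_of_set X"] by (auto simp: A_def)
  moreover have "top_of_set (X - A) dim_le 0"
  proof -
    let ?Y = "X - A"
    have YX: "subtopology (top_of_set X) ?Y = top_of_set ?Y"
      by (simp add: subtopology_subtopology Int_absorb1)
    have basis: "is_open_basis (top_of_set ?Y) ((\<lambda>U. ?Y \<inter> U) ` \<C>)"
      using is_open_basis_subtopology[OF \<C>(3), of ?Y] YX by simp
    have "closedin (top_of_set ?Y) W \<and> openin (top_of_set ?Y) W" if W: "W \<in> (\<lambda>U. ?Y \<inter> U) ` \<C>" for W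
    proof -
      obtain U where U: "U \<in> \<C>" "W = ?Y \<inter> U"
        using W by blast
      have "top_of_set ?Y frontier_of W \<subseteq> ?Y \<inter> (top_of_set X frontier_of U)"
        using frontier_of_subtopology_Int_subset[of "top_of_set X" ?Y U] YX U by auto
      also have "\<dots> = {}"
        using U(1) by (auto simp: A_def)
      finally show ?thesis
        using U(2) by (simp add: clopenin_eq_frontier_of)
    qed
    then show ?thesis
      unfolding dimension_le_0_iff_clopen_basis by (intro is_open_basis_superset[OF basis]) auto
  qed
  ultimately show ?thesis
    by (intro that)
qed

theorem theorem4p16:
  fixes X :: "'a::metric_space set" and Xn :: "nat \<Rightarrow> 'a set"
  assumes "separable_space (top_of_set X)"
    and "X = (\<Union>n. Xn n)"
    and "\<And>n. closedin (top_of_set X) (Xn n)"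
  shows "top_hausdorff_dim X = (SUP n. top_hausdorff_dim (Xn n))"
proof (rule antisym)
  show "(SUP n. top_hausdorff_dim (Xn n)) \<le> top_hausdorff_dim X"
    using assms(2) by (intro SUP_least top_hausdorff_dim_mono) auto
  show "top_hausdorff_dim X \<le> (SUP n. top_hausdorff_dim (Xn n))"
  proof (cases "X = {}")
    case True
    then have "Xn n = {}" for n
      using assms(2) by auto
    then show ?thesis
      using True by simp
  next
    case False
    then obtain k where "Xn k \<noteq> {}"
      using assms(2) by auto
    let ?X = "top_of_set X"
    have sc: "second_countable (top_of_set S)" if "S \<subseteq> X" for S
      using second_countable_subtopology[OF separable_imp_second_countable[OF assms(1)], of S] that
      by (simp add: subtopology_subtopology Int_absorb1)
    show ?thesis
    proof (rule dense_ge)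
      fix d assume d: "(SUP n. top_hausdorff_dim (Xn n)) < d"
      have less: "top_hausdorff_dim (Xn n) < d" for n
        using d by (meson SUP_upper UNIV_I le_less_trans)
      have "0 \<le> d"
        using top_hausdorff_dim_nonneg[OF \<open>Xn k \<noteq> {}\<close>] less[of k] by simp
      have "\<exists>A\<subseteq>Xn n. hausdorff_dim A \<le> d - 1 \<and> top_of_set (Xn n - A) dim_le 0" for n
        using top_hausdorff_dim_lessD[OF sc less \<open>0 \<le> d\<close>, of n] assms(2) by blast
      then obtain A where A: "\<And>n. A n \<subseteq> Xn n" "\<And>n. hausdorff_dim (A n) \<le> d - 1"
          "\<And>n. top_of_set (Xn n - A n) dim_le 0"
        by metis
      define N where "N = (\<Union>n. A n)"
      \<comment> \<open>Removing all of \<open>N\<close>, not just \<open>A n\<close>, makes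
        \<open>Z n\<close> the trace of \<open>Xn n\<close> on \<open>X - N\<close>, hence
        relatively closed there. As a subset of \<open>Xn n - A n\<close> it stays
        zero-dimensional.\<close>
      define Z where "Z = (\<lambda>n. Xn n - N)"
      have "hausdorff_dim N \<le> d - 1"
        unfolding N_def using A(2) by (rule hausdorff_dim_UN_le)
      have sub: "subtopology ?X S = top_of_set S" if "S \<subseteq> X" for S
        using that by (simp add: subtopology_subtopology Int_absorb1)
      have ZX: "Z n \<subseteq> X" for n
        using assms(2) by (auto simp: Z_def)
      have "top_of_set (Z n) dim_le 0" for n
      proof -
        have "Z n \<subseteq> Xn n - A n"
          by (auto simp: Z_def N_def)
        then show ?thesis
          using dimension_le_subtopology[OF A(3), of n "Z n"]
          by (simp add: subtopology_subtopology Int_absorb1)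
      qed
      then have Z: "subtopology ?X (Z n) dim_le 0" "Lindelof_space (subtopology ?X (Z n))" for n
        using ZX[of n] sub[of "Z n"] sc[of "Z n"] by (simp_all add: second_countable_imp_Lindelof_space)
      have clZ: "closedin (subtopology ?X (X - N)) (Z n)" for n
      proof -
        have "Z n = (X - N) \<inter> Xn n"
          using assms(2) by (auto simp: Z_def)
        then show ?thesis
          using assms(3) by (auto intro: closedin_subtopology_Int_closed)
      qed
      have UZ: "X - N = (\<Union>n. Z n)"
        using assms(2) by (auto simp: Z_def)
      have met: "metrizable_space ?X"
        by (intro metrizable_space_subtopology metrizable_space_euclidean)
      \<comment> \<open>The largest candidate family is taken, so only arbitrarily small members
        around each point have to be found.\<close>
      define \<B> where "\<B> = {U. openin ?X U \<and> hausdorff_dim (?X frontier_of U) \<le> d - 1}"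
      have "\<exists>U\<in>\<B>. x \<in> U \<and> U \<subseteq> V" if V: "openin ?X V" "x \<in> V" for V x
      proof -
        have "x \<in> X"
          using V openin_imp_subset by blast
        have cl: "closedin ?X {x}" "closedin ?X (X - V)"
          using \<open>x \<in> X\<close> V by (simp_all add: closed_subset closedin_diff)
        have "disjnt {x} (X - V)" "X - N \<subseteq> topspace ?X"
          using V by auto
        then obtain U W where U: "openin ?X U" "openin ?X W" "{x} \<subseteq> U" "X - V \<subseteq> W"
            "disjnt U W" "X - N \<subseteq> U \<union> W"
          using zero_dimensional_sum_subspace_separation[OF met _ UZ clZ Z(2,1) cl] by metis
        \<comment> \<open>A boundary point of the open set \<open>U\<close> lies neither in
          \<open>U\<close> nor in \<open>W\<close>. These two sets cover \<open>X - N\<close>, so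
          the point is in \<open>N\<close>.\<close>
        have "?X closure_of U \<inter> W = {}"
          using U by (metis Int_commute disjnt_def openin_Int_closure_of_eq_empty)
        then have "?X frontier_of U \<subseteq> N"
          using U(6) closure_of_subset_topspace[of ?X U] by (auto simp: frontier_of_openin U(1))
        then have "hausdorff_dim (?X frontier_of U) \<le> d - 1"
          using \<open>hausdorff_dim N \<le> d - 1\<close> hausdorff_dim_mono order_trans by blast
        moreover have "U \<subseteq> V"
          using U openin_imp_subset[OF U(1)] by (auto simp: disjnt_iff)
        ultimately show ?thesis
          using U by (auto simp: \<B>_def)
      qed
      then have "is_open_basis ?X \<B>"
        by (auto simp: is_open_basis_def \<B>_def)
      then show "top_hausdorff_dim X \<le> d"
        using False unfolding top_hausdorff_dim_def \<B>_def by (auto intro!: Inf_lower)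
    qed
  qed
qed

end
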